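(* Let $U$ be an absolute ultrafilter on $\mathbb{N}$. Then the set ${}^\ast\mathbb{R}\setminus\mathbb{R}$, endowed with the topology induced by the space $\widetilde{\mathbb{R}}$ via the injection $h:{}^\ast\mathbb{R}\to\widetilde{\mathbb{R}}$, $h(\overline{x})=U(x)$, is a separated (Hausdorff) topological space.
   Context: $\mathbb{N}$ is the set of non-negative integers and $\mathbb{R}$ carries its usual topology. A nontrivial (i.e. non-principal, free) ultrafilter $U$ on $\mathbb{N}$ is called absolute if for every partition $(Q_n)_{n\ge 0}$ of $\mathbb{N}$ with $Q_n\notin U$ for all $n\ge 0$, there exists $A\in U$ such that $|Q_n\cap A|\le 1$ for all $n\ge 0$. Let $(E;\tau)$ be a topological space. A $\tau$-filter of $E$ is a nonempty collection $\theta\subseteq\tau$ of open sets such that (i) $\emptyset\notin\theta$; (ii) $A,B\in\theta$ implies $A\cap B\in\theta$; (iii) $A\in\theta$ and $A\subseteq B\in\tau$ imply $B\in\theta$. It is a saturated filter ($s$-filter) if moreover (iv) for $A,B\in\tau$ with $A\cup B\in\theta$, one has $A\in\theta$ or $B\in\theta$. $\widetilde{E}$ denotes the set of all $s$-filters of $E$, with the canonical topology having as base the sets $\widetilde{A}=\{\theta\in\widetilde{E}\mid A\in\theta\}$, $A\in\tau$. For a real sequence $x=(x_n)_{n\ge 0}$, $U(x)\in\widetilde{\mathbb{R}}$ is the $s$-filter of all open $W\subseteq\mathbb{R}$ with $\{n\in\mathbb{N}\mid x_n\in W\}\in U$. Two real sequences $x,y$ are $U$-equivalent if $\{n\mid x_n=y_n\}\in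 U$; $\overline{x}$ is the class of $x$, and ${}^\ast\mathbb{R}$ is the set of all classes (hyperreals modulo $U$). $\mathbb{R}$ is identified with the subset of ${}^\ast\mathbb{R}$ consisting of the classes of constant sequences. The map $h:{}^\ast\mathbb{R}\to\widetilde{\mathbb{R}}$, $h(\overline{x})=U(x)$, is well defined and injective, so ${}^\ast\mathbb{R}$ is identified with a subset of $\widetilde{\mathbb{R}}$ and given the induced topology. *)

theory Defs
  imports "HOL-Analysis.Analysis"
begin

section \<open>Absolute ultrafilters\<close>

text \<open>
  Ultrafilters on \<open>\<nat>\<close> are represented by the library type of filters; a set \<open>A\<close> belongs to
  the filter \<open>U\<close> iff \<^term>\<open>eventually (\<lambda>n. n \<in> A) U\<close>.
\<close>

definition in_filter :: "'a set \<Rightarrow> 'a filter \<Rightarrow> bool" where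
  "in_filter A U \<longleftrightarrow> eventually (\<lambda>n. n \<in> A) U"

definition ultrafilter :: "'a filter \<Rightarrow> bool" where
  "ultrafilter U \<longleftrightarrow> U \<noteq> bot \<and> (\<forall>A. in_filter A U \<or> in_filter (- A) U)"

definition nontrivial_ultrafilter :: "'a filter \<Rightarrow> bool" where
  "nontrivial_ultrafilter U \<longleftrightarrow> ultrafilter U \<and> (\<forall>A. U \<noteq> principal A)"

definition is_partition_seq :: "(nat \<Rightarrow> nat set) \<Rightarrow> bool" where
  "is_partition_seq Q \<longleftrightarrow> disjoint_family Q \<and> (\<Union>n. Q n) = UNIV"

text \<open>
  Members of a partition sequence may be empty; by \<open>absolute_ultrafilter_iff_nonempty\<close> below
  this makes no difference. Finiteness is stated because the cardinality of an infinite set is 0.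
\<close>

definition absolute_ultrafilter :: "nat filter \<Rightarrow> bool" where
  "absolute_ultrafilter U \<longleftrightarrow> nontrivial_ultrafilter U \<and>
     (\<forall>Q. is_partition_seq Q \<and> (\<forall>n. \<not> in_filter (Q n) U) \<longrightarrow>
        (\<exists>A. in_filter A U \<and> (\<forall>n. finite (Q n \<inter> A) \<and> card (Q n \<inter> A) \<le> 1)))"

section \<open>Saturated filters of open sets\<close>

definition tau_filter :: "'a topology \<Rightarrow> 'a set set \<Rightarrow> bool" where
  "tau_filter \<tau> \<theta> \<longleftrightarrow>
     \<theta> \<noteq> {} \<and> (\<forall>A\<in>\<theta>. openin \<tau> A) \<and>
     {} \<notin> \<theta> \<and>
     (\<forall>A B. A \<in> \<theta> \<and> B \<in> \<theta> \<longrightarrow> A \<inter> B \<in> \<theta>) \<and>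
     (\<forall>A B. A \<in> \<theta> \<and> A \<subseteq> B \<and> openin \<tau> B \<longrightarrow> B \<in> \<theta>)"

definition s_filter :: "'a topology \<Rightarrow> 'a set set \<Rightarrow> bool" where
  "s_filter \<tau> \<theta> \<longleftrightarrow> tau_filter \<tau> \<theta> \<and>
     (\<forall>A B. openin \<tau> A \<and> openin \<tau> B \<and> A \<union> B \<in> \<theta> \<longrightarrow> A \<in> \<theta> \<or> B \<in> \<theta>)"

definition s_filters :: "'a topology \<Rightarrow> 'a set set set" where
  "s_filters \<tau> = {\<theta>. s_filter \<tau> \<theta>}"

definition s_basic :: "'a topology \<Rightarrow> 'a set \<Rightarrow> 'a set set set" where
  "s_basic \<tau> A = {\<theta> \<in> s_filters \<tau>. A \<in> \<theta>}"

definition s_topology :: "'a topology \<Rightarrow> 'a set set topology" where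
  "s_topology \<tau> = topology (arbitrary union_of (\<lambda>S. \<exists>A. openin \<tau> A \<and> S = s_basic \<tau> A))"

section \<open>Hyperreals modulo an ultrafilter\<close>

definition seq_s_filter :: "nat filter \<Rightarrow> (nat \<Rightarrow> real) \<Rightarrow> real set set" where
  "seq_s_filter U x = {W. open W \<and> in_filter {n. x n \<in> W} U}"

definition seq_equiv :: "nat filter \<Rightarrow> ((nat \<Rightarrow> real) \<times> (nat \<Rightarrow> real)) set" where
  "seq_equiv U = {(x, y). in_filter {n. x n = y n} U}"

definition hyperreals :: "nat filter \<Rightarrow> (nat \<Rightarrow> real) set set" where
  "hyperreals U = UNIV // seq_equiv U"

definition standard_reals :: "nat filter \<Rightarrow> (nat \<Rightarrow> real) set set" where
  "standard_reals U = (\<lambda>c. seq_equiv U `` {\<lambda>n. c}) ` UNIV"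

text \<open>
  All representatives of a class induce the same s-filter, so the image below is a singleton;
  see \<open>hyper_embed_class\<close>.
\<close>

definition hyper_embed :: "nat filter \<Rightarrow> (nat \<Rightarrow> real) set \<Rightarrow> real set set" where
  "hyper_embed U X = the_elem (seq_s_filter U ` X)"

section \<open>Well-definedness\<close>

lemma tau_filter_Int: "tau_filter \<tau> \<theta> \<Longrightarrow> A \<in> \<theta> \<Longrightarrow> B \<in> \<theta> \<Longrightarrow> A \<inter> B \<in> \<theta>"
  unfolding tau_filter_def by blast

lemma tau_filter_mono: "tau_filter \<tau> \<theta> \<Longrightarrow> A \<in> \<theta> \<Longrightarrow> A \<subseteq> B \<Longrightarrow> openin \<tau> B \<Longrightarrow> B \<in> \<theta>"
  unfolding tau_filter_def by meson

lemma s_basic_Int: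
  assumes "openin \<tau> A" "openin \<tau> B"
  shows "s_basic \<tau> A \<inter> s_basic \<tau> B = s_basic \<tau> (A \<inter> B)"
proof -
  have "A \<in> \<theta> \<and> B \<in> \<theta> \<longleftrightarrow> A \<inter> B \<in> \<theta>" if "s_filter \<tau> \<theta>" for \<theta>
  proof -
    have t: "tau_filter \<tau> \<theta>"
      using that unfolding s_filter_def by (rule conjunct1)
    show ?thesis
    proof
      show "A \<in> \<theta> \<and> B \<in> \<theta> \<Longrightarrow> A \<inter> B \<in> \<theta>"
        using tau_filter_Int[OF t] by (elim conjE)
      assume AB: "A \<inter> B \<in> \<theta>"
      show "A \<in> \<theta> \<and> B \<in> \<theta>"
        using tau_filter_mono[OF t AB Int_lower1 assms(1)]
          tau_filter_mono[OF t AB Int_lower2 assms(2)] by (rule conjI)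
    qed
  qed
  then show ?thesis
    by (auto simp: s_basic_def s_filters_def)
qed

lemma openin_s_topology:
  "openin (s_topology \<tau>) = arbitrary union_of (\<lambda>S. \<exists>A. openin \<tau> A \<and> S = s_basic \<tau> A)"
proof -
  have "istopology (arbitrary union_of (\<lambda>S. \<exists>A. openin \<tau> A \<and> S = s_basic \<tau> A))"
  proof (rule istopology_base)
    fix S T
    assume "\<exists>A. openin \<tau> A \<and> S = s_basic \<tau> A" "\<exists>A. openin \<tau> A \<and> T = s_basic \<tau> A"
    then obtain A B where "openin \<tau> A" "S = s_basic \<tau> A" "openin \<tau> B" "T = s_basic \<tau> B"
      by blast
    then show "\<exists>A. openin \<tau> A \<and> S \<inter> T = s_basic \<tau> A"
      by (intro exI[of _ "A \<inter> B"]) (simp add: s_basic_Int openin_Int)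
  qed
  then show ?thesis
    unfolding s_topology_def by (simp add: topology_inverse')
qed

lemma openin_s_basic: "openin \<tau> A \<Longrightarrow> openin (s_topology \<tau>) (s_basic \<tau> A)"
  unfolding openin_s_topology by (rule union_of_inc) (auto simp: arbitrary_def)

lemma topspace_s_topology: "topspace (s_topology \<tau>) = s_filters \<tau>"
proof
  show "topspace (s_topology \<tau>) \<subseteq> s_filters \<tau>"
    using openin_topspace[of "s_topology \<tau>"]
    unfolding openin_s_topology union_of_def s_basic_def by blast
  have "topspace \<tau> \<in> \<theta>" if "s_filter \<tau> \<theta>" for \<theta>
  proof -
    have t: "tau_filter \<tau> \<theta>"
      using that unfolding s_filter_def by (rule conjunct1)
    then obtain A where A: "A \<in> \<theta>" "openin \<tau> A"
      unfolding tau_filter_def by (elim conjE) blast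
    show ?thesis
      by (rule tau_filter_mono[OF t A(1) openin_subset[OF A(2)] openin_topspace])
  qed
  then have "s_basic \<tau> (topspace \<tau>) = s_filters \<tau>"
    by (auto simp: s_basic_def s_filters_def)
  then show "s_filters \<tau> \<subseteq> topspace (s_topology \<tau>)"
    using openin_subset[OF openin_s_basic[OF openin_topspace]] by metis
qed

lemma seq_s_filter_in_s_filters:
  assumes "ultrafilter U"
  shows "seq_s_filter U x \<in> s_filters (euclidean :: real topology)"
proof -
  have nb: "\<not> eventually (\<lambda>n. False) U"
    using assms by (simp add: ultrafilter_def trivial_limit_def)
  have dich: "eventually P U \<or> eventually (\<lambda>n. \<not> P n) U" for P
    using assms[unfolded ultrafilter_def in_filter_def, THEN conjunct2, rule_format, of "{n. P n}"]
    by simp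
  have 1: "UNIV \<in> seq_s_filter U x"
    by (simp add: seq_s_filter_def in_filter_def)
  have 2: "A \<in> seq_s_filter U x \<or> B \<in> seq_s_filter U x"
    if "open A" "open B" "A \<union> B \<in> seq_s_filter U x" for A B
  proof (rule disjCI)
    assume "B \<notin> seq_s_filter U x"
    then have "eventually (\<lambda>n. x n \<notin> B) U"
      using that dich[of "\<lambda>n. x n \<in> B"] by (simp add: seq_s_filter_def in_filter_def)
    moreover have "eventually (\<lambda>n. x n \<in> A \<or> x n \<in> B) U"
      using that by (simp add: seq_s_filter_def in_filter_def)
    ultimately have "eventually (\<lambda>n. x n \<in> A) U"
      by eventually_elim auto
    then show "A \<in> seq_s_filter U x"
      using that by (simp add: seq_s_filter_def in_filter_def)
  qed
  have 3: "B \<in> seq_s_filter U x" if "A \<in> seq_s_filter U x" "A \<subseteq> B" "open B" for A B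
    using that by (auto simp: seq_s_filter_def in_filter_def elim: eventually_mono)
  have 4: "\<forall>A\<in>seq_s_filter U x. open A" "{} \<notin> seq_s_filter U x"
    using nb by (auto simp: seq_s_filter_def in_filter_def)
  have 5: "A \<inter> B \<in> seq_s_filter U x" if "A \<in> seq_s_filter U x" "B \<in> seq_s_filter U x" for A B
    using that by (simp add: seq_s_filter_def in_filter_def eventually_conj_iff open_Int)
  show ?thesis
    unfolding s_filters_def s_filter_def tau_filter_def mem_Collect_eq open_openin[symmetric]
  proof (intro conjI allI impI; (elim conjE)?)
    show "seq_s_filter U x \<noteq> {}"
      using 1 by blast
    show "\<forall>A\<in>seq_s_filter U x. open A" "{} \<notin> seq_s_filter U x"
      by (fact 4)+
  qed (erule (2) 2 3 5 | erule (1) 5)+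
qed

lemma equiv_seq_equiv: "equiv UNIV (seq_equiv U)"
proof (rule equivI)
  show "trans (seq_equiv U)"
    by (rule transI) (auto simp: seq_equiv_def in_filter_def elim: eventually_elim2)
qed (auto simp: seq_equiv_def in_filter_def refl_on_def sym_def eq_commute)

lemma seq_s_filter_cong:
  assumes "(x, y) \<in> seq_equiv U"
  shows "seq_s_filter U x = seq_s_filter U y"
proof -
  have e: "eventually (\<lambda>n. x n = y n) U"
    using assms by (simp add: seq_equiv_def in_filter_def)
  have "eventually (\<lambda>n. x n \<in> W) U = eventually (\<lambda>n. y n \<in> W) U" for W
    by (rule eventually_cong[OF e]) simp
  then show ?thesis
    by (simp add: seq_s_filter_def in_filter_def)
qed

lemma hyper_embed_class: "hyper_embed U (seq_equiv U `` {x}) = seq_s_filter U x"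
proof -
  have "x \<in> seq_equiv U `` {x}"
    by (simp add: seq_equiv_def in_filter_def)
  moreover have "seq_s_filter U y = seq_s_filter U x" if "y \<in> seq_equiv U `` {x}" for y
    using that seq_s_filter_cong by blast
  ultimately have "seq_s_filter U ` (seq_equiv U `` {x}) = {seq_s_filter U x}"
    by blast
  then show ?thesis
    by (simp add: hyper_embed_def)
qed

lemma hyper_embed_in_s_filters:
  assumes "ultrafilter U" "X \<in> hyperreals U"
  shows "hyper_embed U X \<in> s_filters (euclidean :: real topology)"
  using assms by (auto simp: hyperreals_def hyper_embed_class seq_s_filter_in_s_filters
      elim!: quotientE)

lemma absolute_ultrafilter_iff_nonempty:
  "absolute_ultrafilter U \<longleftrightarrow> nontrivial_ultrafilter U \<and>
     (\<forall>Q. is_partition_seq Q \<and> (\<forall>n. Q n \<noteq> {}) \<and> (\<forall>n. \<not> in_filter (Q n) U) \<longrightarrow>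
        (\<exists>A. in_filter A U \<and> (\<forall>n. finite (Q n \<inter> A) \<and> card (Q n \<inter> A) \<le> 1)))"
    (is "_ \<longleftrightarrow> ?N \<and> ?P")
proof
  assume "absolute_ultrafilter U"
  then show "?N \<and> ?P" by (auto simp: absolute_ultrafilter_def)
next
  assume NP: "?N \<and> ?P"
  have "\<exists>A. in_filter A U \<and> (\<forall>n. finite (Q n \<inter> A) \<and> card (Q n \<inter> A) \<le> 1)"
    if Q: "is_partition_seq Q" "\<forall>n. \<not> in_filter (Q n) U" for Q
  proof -
    define I where "I = {n. Q n \<noteq> {}}"
    have U: "ultrafilter U" using NP by (simp add: nontrivial_ultrafilter_def)
    have inf: "infinite I"
    proof
      assume "finite I"
      moreover have "\<forall>n\<in>I. eventually (\<lambda>k. k \<notin> Q n) U"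
        using Q(2) U by (auto simp: ultrafilter_def in_filter_def)
      ultimately have "eventually (\<lambda>k. \<forall>n\<in>I. k \<notin> Q n) U"
        by (simp add: eventually_ball_finite)
      moreover have "\<not> (\<forall>n\<in>I. k \<notin> Q n)" for k
        using Q(1) unfolding is_partition_seq_def I_def by blast
      ultimately have "eventually (\<lambda>k. False) U"
        by simp
      then show False
        using U by (simp add: ultrafilter_def trivial_limit_def)
    qed
    let ?e = "enumerate I"
    have e: "inj ?e" "range ?e = I"
      using inf by (auto simp: strict_mono_enumerate strict_mono_imp_inj_on range_enumerate)
    have "is_partition_seq (Q \<circ> ?e)"
    proof -
      have "disjoint_family (Q \<circ> ?e)"
        using Q(1) e(1) unfolding is_partition_seq_def disjoint_family_on_def inj_def
        by (metis UNIV_I comp_apply)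
      moreover have "(\<Union>n. Q n) = (\<Union>n\<in>I. Q n)"
        by (auto simp: I_def)
      then have "(\<Union>n\<in>range ?e. Q n) = UNIV"
        using Q(1) unfolding is_partition_seq_def e(2) by simp
      then have "(\<Union>n. (Q \<circ> ?e) n) = UNIV"
        by (simp add: image_image)
      ultimately show ?thesis by (simp add: is_partition_seq_def)
    qed
    moreover have "(Q \<circ> ?e) n \<noteq> {}" for n
    proof -
      have "?e n \<in> I" using e(2) by blast
      then show ?thesis by (simp add: I_def)
    qed
    moreover have "\<not> in_filter ((Q \<circ> ?e) n) U" for n
      using Q(2) by simp
    ultimately obtain A where A: "in_filter A U"
      "\<And>n. finite ((Q \<circ> ?e) n \<inter> A) \<and> card ((Q \<circ> ?e) n \<inter> A) \<le> 1"
      using NP[THEN conjunct2, rule_format, of "Q \<circ> ?e"] by blast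
    have "finite (Q n \<inter> A) \<and> card (Q n \<inter> A) \<le> 1" for n
    proof (cases "n \<in> I")
      case True
      then obtain m where "n = ?e m" using e(2) by blast
      then show ?thesis using A(2)[of m] by simp
    qed (simp add: I_def)
    then show ?thesis using A(1) by blast
  qed
  then show "absolute_ultrafilter U"
    using NP unfolding absolute_ultrafilter_def by blast
qed

end

theory Submission
  imports Defs
begin

text \<open>
  Composing with \<open>arctan\<close> makes all sequences bounded, so that they have limits along \<open>U\<close>.
  Different limits separate two sequences at once. If both converge to \<open>L\<close>, absoluteness yields a
  set \<open>B \<in> U\<close> on which \<open>x\<close> and \<open>y\<close> are injective, avoid \<open>L\<close> and accumulate only at \<open>L\<close>. When
  \<open>x\<close> is closer to \<open>L\<close> than \<open>y\<close> on \<open>B\<close>, the relation \<open>x\<^sub>n = y\<^sub>m\<close> between indices is well-founded and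
  every index has at most one predecessor, so it can be 2-coloured; on a colour class in \<open>U\<close> the
  ranges of \<open>x\<close> and \<open>y\<close> are disjoint, and neither meets the closure of the other.
\<close>

section \<open>Limits along an ultrafilter\<close>

lemma ultrafilter_eventually_cases:
  assumes "ultrafilter U"
  shows "eventually P U \<or> eventually (\<lambda>n. \<not> P n) U"
  using assms[unfolded ultrafilter_def in_filter_def, THEN conjunct2, rule_format, of "{n. P n}"]
  by simp

lemma ultrafilter_not_eventually_iff:
  assumes "ultrafilter U"
  shows "\<not> eventually P U \<longleftrightarrow> eventually (\<lambda>n. \<not> P n) U"
proof -
  have "\<not> (eventually P U \<and> eventually (\<lambda>n. \<not> P n) U)"
    using assms by (auto simp: ultrafilter_def trivial_limit_def simp flip: eventually_conj_iff)
  then show ?thesis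
    using ultrafilter_eventually_cases[OF assms] by blast
qed

text \<open>Compactness gives the image filter a cluster point \<open>L\<close>. An ultrafilter
  decides every neighbourhood of \<open>L\<close>, and rejecting one would contradict clustering, so
  \<open>L\<close> is a limit.\<close>

lemma ultrafilter_tendsto_compact:
  fixes x :: "'b \<Rightarrow> 'a::topological_space"
  assumes U: "ultrafilter U" and K: "compact K" "eventually (\<lambda>n. x n \<in> K) U"
  obtains L where "L \<in> K" "(x \<longlongrightarrow> L) U"
proof -
  have "filtermap x U \<noteq> bot"
    using U by (simp add: ultrafilter_def filtermap_bot_iff)
  then obtain L where L: "L \<in> K" "inf (nhds L) (filtermap x U) \<noteq> bot"
    using K unfolding compact_filter by (auto simp: eventually_filtermap)
  have "eventually (\<lambda>n. x n \<in> S) U" if S: "open S" "L \<in> S" for S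
  proof (rule ccontr)
    assume "\<not> eventually (\<lambda>n. x n \<in> S) U"
    then have "eventually (\<lambda>z. z \<notin> S) (filtermap x U)"
      using ultrafilter_not_eventually_iff[OF U] by (simp add: eventually_filtermap)
    then have "eventually (\<lambda>z. False) (inf (nhds L) (filtermap x U))"
      using eventually_nhds_in_open[OF S] unfolding eventually_inf by blast
    then show False
      using L(2) by (simp add: trivial_limit_def)
  qed
  then show ?thesis
    using that[OF L(1)] by (simp add: tendsto_def)
qed

section \<open>Selectivity of absolute ultrafilters\<close>

text \<open>Apply absoluteness to the partition of the indices into fibres of \<open>g\<close>:
  meeting each fibre at most once is injectivity. This is the usual selectivity property.\<close>

lemma absolute_ultrafilter_imp_inj_on:
  fixes g :: "nat \<Rightarrow> nat"
  assumes U: "absolute_ultrafilter U" and g: "\<And>k. \<not> eventually (\<lambda>n. g n = k) U"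
  obtains A where "eventually (\<lambda>n. n \<in> A) U" "inj_on g A"
proof -
  let ?Q = "\<lambda>k. {n. g n = k}"
  have "is_partition_seq ?Q" "\<forall>k. \<not> in_filter (?Q k) U"
    using g by (auto simp: is_partition_seq_def disjoint_family_on_def in_filter_def)
  then obtain A where A: "in_filter A U" "\<And>k. finite (?Q k \<inter> A) \<and> card (?Q k \<inter> A) \<le> 1"
    using U unfolding absolute_ultrafilter_def by blast
  have "inj_on g A"
  proof (rule inj_onI)
    fix m n assume "m \<in> A" "n \<in> A" "g m = g n"
    then have "m \<in> ?Q (g n) \<inter> A" "n \<in> ?Q (g n) \<inter> A"
      by auto
    then show "m = n"
      using A(2)[of "g n"] card_le_Suc0_iff_eq unfolding One_nat_def by blast
  qed
  then show ?thesis
    using that A(1) by (auto simp: in_filter_def)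
qed

text \<open>The function \<open>g\<close> numbers shells around \<open>L\<close> that shrink towards
  it. As \<open>x\<close> tends to \<open>L\<close> without equalling it, no shell carries a set of
  \<open>U\<close>, so selectivity leaves at most one index per shell, and only finitely many shells
  reach outside a given ball.\<close>

lemma absolute_ultrafilter_tendsto_imp_sparse:
  fixes x :: "nat \<Rightarrow> 'a::metric_space"
  assumes U: "absolute_ultrafilter U" and lim: "(x \<longlongrightarrow> L) U" and ne: "eventually (\<lambda>n. x n \<noteq> L) U"
  obtains A where "eventually (\<lambda>n. n \<in> A) U" "inj_on x A" "L \<notin> x ` A"
    "\<And>e. e > 0 \<Longrightarrow> finite {n \<in> A. dist (x n) L \<ge> e}"
proof -
  have UF: "ultrafilter U"
    using U by (simp add: absolute_ultrafilter_def nontrivial_ultrafilter_def)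
  define g where "g = (\<lambda>n. nat \<lfloor>1 / dist (x n) L\<rfloor>)"
  have "\<not> eventually (\<lambda>n. g n = k) U" for k
  proof -
    have "eventually (\<lambda>n. dist (x n) L < 1 / (real k + 1)) U"
      using lim by (rule tendstoD) simp
    \<comment> \<open>Here \<open>ne\<close> matters: where \<open>x n = L\<close>, the convention
      \<open>1 / 0 = 0\<close> would give \<open>g n = 0\<close>.\<close>
    with ne have "eventually (\<lambda>n. g n \<noteq> k) U"
    proof eventually_elim
      case (elim n)
      then have "real k + 1 < 1 / dist (x n) L"
        by (simp add: field_simps)
      then have "int k + 1 \<le> \<lfloor>1 / dist (x n) L\<rfloor>"
        by (simp add: le_floor_iff)
      then show ?case
        unfolding g_def by linarith
    qed
    then show ?thesis
      by (simp add: ultrafilter_not_eventually_iff[OF UF])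
  qed
  then obtain A where A: "eventually (\<lambda>n. n \<in> A) U" "inj_on g A"
    using absolute_ultrafilter_imp_inj_on[OF U] by blast
  define B where "B = {n \<in> A. x n \<noteq> L}"
  have gB: "inj_on g B"
    using A(2) by (rule inj_on_subset) (auto simp: B_def)
  show ?thesis
  proof (rule that[of B])
    show "eventually (\<lambda>n. n \<in> B) U"
      using A(1) ne by eventually_elim (simp add: B_def)
    \<comment> \<open>The value \<open>g n\<close> depends on \<open>x n\<close> only, so
      injectivity passes from \<open>g\<close> to \<open>x\<close>.\<close>
    show "inj_on x B"
      using gB by (auto simp: inj_on_def g_def)
    show "L \<notin> x ` B"
      by (auto simp: B_def)
    fix e :: real assume "e > 0"
    let ?C = "{n \<in> B. dist (x n) L \<ge> e}"
    have "g ` ?C \<subseteq> {..nat \<lfloor>1 / e\<rfloor>}"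
      using \<open>e > 0\<close> by (auto simp: g_def B_def intro!: nat_mono floor_mono divide_left_mono)
    then have "finite (g ` ?C)"
      by (rule finite_subset) simp
    then show "finite ?C"
      by (rule finite_imageD) (rule inj_on_subset[OF gB], blast)
  qed
qed

section \<open>Metric separation and two-colouring\<close>

text \<open>Outside a ball around \<open>L\<close> of half the distance from \<open>z\<close> to
  \<open>L\<close> there are only finitely many values of \<open>y\<close>. These together with the
  ball form a closed set, and a limit point \<open>z\<close> must be one of the values.\<close>

lemma closure_image_sparse_subset:
  fixes y :: "'b \<Rightarrow> 'a::metric_space"
  assumes "\<And>e. e > 0 \<Longrightarrow> finite {n \<in> B. dist (y n) L \<ge> e}"
  shows "closure (y ` B) \<subseteq> insert L (y ` B)"
proof
  fix z assume z: "z \<in> closure (y ` B)"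
  show "z \<in> insert L (y ` B)"
  proof (rule ccontr)
    assume nz: "z \<notin> insert L (y ` B)"
    define d where "d = dist z L / 2"
    have d: "d > 0"
      using nz by (simp add: d_def)
    let ?F = "y ` {n \<in> B. dist (y n) L \<ge> d}"
    have "closed (?F \<union> cball L d)"
      using assms[OF d] by (intro closed_Un finite_imp_closed finite_imageI closed_cball)
    moreover have "y ` B \<subseteq> ?F \<union> cball L d"
      by (auto simp: dist_commute not_le)
    ultimately have "z \<in> ?F \<union> cball L d"
      using z closure_minimal by blast
    moreover have "dist L z > d"
      using d by (simp add: d_def dist_commute)
    ultimately show False
      using nz by auto
  qed
qed

text \<open>Compare distances: take the points nearer to \<open>S\<close> and those nearer to
  \<open>T\<close>. Nonemptiness is assumed because \<open>infdist\<close> to the empty set is 0 by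
  convention.\<close>

lemma separated_sets_disjoint_open:
  fixes S T :: "'a::metric_space set"
  assumes "S \<inter> closure T = {}" "T \<inter> closure S = {}" "S \<noteq> {}" "T \<noteq> {}"
  obtains V W where "open V" "open W" "S \<subseteq> V" "T \<subseteq> W" "V \<inter> W = {}"
proof (rule that)
  show "open {z. infdist z S < infdist z T}" "open {z. infdist z T < infdist z S}"
    by (intro open_Collect_less continuous_intros)+
  have *: "infdist z A < infdist z B" if "z \<in> A" "A \<inter> closure B = {}" "B \<noteq> {}" for z and A B :: "'a set"
  proof -
    have "infdist z B \<noteq> 0"
      using that in_closure_iff_infdist_zero[of B z] by blast
    then show ?thesis
      using that(1) infdist_nonneg[of z B] by simp
  qed
  show "S \<subseteq> {z. infdist z S < infdist z T}" "T \<subseteq> {z. infdist z T < infdist z S}"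
    using * assms by blast+
qed auto

text \<open>Colour by recursion: \<open>b\<close> is true iff no predecessor is. Since a predecessor
  is unique, this makes \<open>b\<close> opposite to it.\<close>

lemma wf_functional_two_colouring:
  assumes "wf r" and uniq: "\<And>a b c. (a, c) \<in> r \<Longrightarrow> (b, c) \<in> r \<Longrightarrow> a = b"
  obtains col :: "'a \<Rightarrow> bool" where "\<forall>(a, b) \<in> r. col a \<noteq> col b"
proof -
  define col where "col = wfrec r (\<lambda>c b. \<forall>a. (a, b) \<in> r \<longrightarrow> \<not> c a)"
  have col: "col b \<longleftrightarrow> (\<forall>a. (a, b) \<in> r \<longrightarrow> \<not> col a)" for b
    by (subst def_wfrec[OF col_def[THEN eq_reflection] \<open>wf r\<close>]) (auto simp: cut_apply)
  have "col a \<noteq> col b" if ab: "(a, b) \<in> r" for a b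
  proof -
    have "(\<forall>a'. (a', b) \<in> r \<longrightarrow> \<not> col a') \<longleftrightarrow> \<not> col a"
      using ab uniq by blast
    then show ?thesis
      using col[of b] by blast
  qed
  then show ?thesis
    using that[of col] by blast
qed

section \<open>Separating two sequences along an ultrafilter\<close>

text \<open>For real sequences this expresses separation of the induced s-filters by basic open
  sets, phrased so that the analysis can proceed without s-filters.\<close>

definition filter_separated :: "'b filter \<Rightarrow> ('b \<Rightarrow> 'a::topological_space) \<Rightarrow> ('b \<Rightarrow> 'a) \<Rightarrow> bool"
  where "filter_separated U x y \<longleftrightarrow> (\<exists>V W. open V \<and> open W \<and> V \<inter> W = {} \<and>
    eventually (\<lambda>n. x n \<in> V) U \<and> eventually (\<lambda>n. y n \<in> W) U)"

lemma filter_separatedI: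
  assumes "open V" "open W" "V \<inter> W = {}"
    "eventually (\<lambda>n. x n \<in> V) U" "eventually (\<lambda>n. y n \<in> W) U"
  shows "filter_separated U x y"
  using assms unfolding filter_separated_def by blast

lemma filter_separated_sym: "filter_separated U x y \<Longrightarrow> filter_separated U y x"
  unfolding filter_separated_def by (metis Int_commute)

text \<open>The assumption \<open>closer\<close> orients the coincidences \<open>x n = y m\<close>:
  they always lead from an index with \<open>y\<close> farther from \<open>L\<close> to one with
  \<open>y\<close> nearer. This excludes cycles, in particular odd ones, which would obstruct a
  2-colouring.\<close>

lemma filter_separated_of_closer:
  fixes x y :: "nat \<Rightarrow> 'a::metric_space"
  assumes U: "absolute_ultrafilter U"
    and lim: "(x \<longlongrightarrow> L) U" "(y \<longlongrightarrow> L) U"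
    and ne: "eventually (\<lambda>n. x n \<noteq> L) U" "eventually (\<lambda>n. y n \<noteq> L) U"
    and closer: "eventually (\<lambda>n. dist (x n) L < dist (y n) L) U"
  shows "filter_separated U x y"
proof -
  have UF: "ultrafilter U"
    using U by (simp add: absolute_ultrafilter_def nontrivial_ultrafilter_def)
  obtain A1 where A1: "eventually (\<lambda>n. n \<in> A1) U" "inj_on x A1" "L \<notin> x ` A1"
      "\<And>e. e > 0 \<Longrightarrow> finite {n \<in> A1. dist (x n) L \<ge> e}"
    using absolute_ultrafilter_tendsto_imp_sparse[OF U lim(1) ne(1)] by metis
  obtain A2 where A2: "eventually (\<lambda>n. n \<in> A2) U" "inj_on y A2" "L \<notin> y ` A2"
      "\<And>e. e > 0 \<Longrightarrow> finite {n \<in> A2. dist (y n) L \<ge> e}"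
    using absolute_ultrafilter_tendsto_imp_sparse[OF U lim(2) ne(2)] by metis
  define B where "B = {n \<in> A1 \<inter> A2. dist (x n) L < dist (y n) L}"
  have B: "eventually (\<lambda>n. n \<in> B) U"
    using A1(1) A2(1) closer by eventually_elim (simp add: B_def)
  define r where "r = {(n, m). n \<in> B \<and> m \<in> B \<and> x n = y m}"
  \<comment> \<open>The rank counts the indices whose \<open>y\<close> is farther from
    \<open>L\<close>, a finite number by sparseness. If \<open>x n = y m\<close>, then
    \<open>n\<close> itself is counted for \<open>m\<close> but not for \<open>n\<close>, so the
    rank strictly increases.\<close>
  define rk where "rk = (\<lambda>m. card {k \<in> B. dist (y k) L > dist (y m) L})"
  have fin: "finite {k \<in> B. dist (y k) L > dist (y m) L}" if "m \<in> B" for m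
  proof (rule finite_subset)
    have "y m \<noteq> L"
      using that A2(3) by (auto simp: B_def)
    then show "finite {k \<in> A2. dist (y k) L \<ge> dist (y m) L}"
      by (intro A2(4)) simp
  qed (auto simp: B_def)
  have "r \<subseteq> Wellfounded.measure rk"
  proof (clarsimp simp: r_def)
    fix n m assume nm: "n \<in> B" "m \<in> B" "x n = y m"
    then have "dist (y m) L < dist (y n) L"
      by (metis (mono_tags, lifting) B_def mem_Collect_eq)
    then show "rk n < rk m"
      unfolding rk_def using nm by (intro psubset_card_mono fin) auto
  qed
  then have wf: "wf r"
    by (rule wf_subset[OF wf_measure])
  have uniq: "a = b" if "(a, c) \<in> r" "(b, c) \<in> r" for a b c
    using that inj_onD[OF A1(2), of a b] by (auto simp: r_def B_def)
  obtain col :: "nat \<Rightarrow> bool" where col: "\<forall>(a, b) \<in> r. col a \<noteq> col b"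
    by (rule wf_functional_two_colouring[OF wf uniq])
  obtain t where t: "eventually (\<lambda>n. col n = t) U"
  proof (cases "eventually col U")
    case True
    then show ?thesis
      using that[of True] by simp
  next
    case False
    then show ?thesis
      using that[of False] ultrafilter_eventually_cases[OF UF, of col] by simp
  qed
  define C where "C = {n \<in> B. col n = t}"
  have C: "eventually (\<lambda>n. n \<in> C) U"
    using B t by eventually_elim (simp add: C_def)
  have disj: "x ` C \<inter> y ` C = {}"
  proof (rule ccontr)
    assume "x ` C \<inter> y ` C \<noteq> {}"
    then obtain n m where "n \<in> C" "m \<in> C" "x n = y m"
      by auto
    then show False
      using col by (auto simp: C_def r_def)
  qed
  have notL: "L \<notin> x ` C" "L \<notin> y ` C"
    using A1(3) A2(3) by (auto simp: C_def B_def)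
  have "closure (x ` C) \<subseteq> insert L (x ` C)"
    by (rule closure_image_sparse_subset) (rule finite_subset[OF _ A1(4)], auto simp: C_def B_def)
  moreover have "closure (y ` C) \<subseteq> insert L (y ` C)"
    by (rule closure_image_sparse_subset) (rule finite_subset[OF _ A2(4)], auto simp: C_def B_def)
  moreover have "C \<noteq> {}"
    using C UF by (auto simp: ultrafilter_def trivial_limit_def)
  \<comment> \<open>The only point a closure can add is \<open>L\<close>, which lies in neither
    image.\<close>
  ultimately have "x ` C \<inter> closure (y ` C) = {}" "y ` C \<inter> closure (x ` C) = {}"
      "x ` C \<noteq> {}" "y ` C \<noteq> {}"
    using disj notL by auto
  then obtain V W where VW: "open V" "open W" "x ` C \<subseteq> V" "y ` C \<subseteq> W" "V \<inter> W = {}"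
    by (rule separated_sets_disjoint_open)
  show ?thesis
    using VW(1,2,5)
  proof (rule filter_separatedI)
    show "eventually (\<lambda>n. x n \<in> V) U" "eventually (\<lambda>n. y n \<in> W) U"
      using C VW(3,4) by (auto elim!: eventually_mono)
  qed
qed

text \<open>The ultrafilter decides which sequence is closer to \<open>L\<close>. In the remaining
  case of equal distances, distinct reals are mirror images about \<open>L\<close>, and the two open
  half-lines at \<open>L\<close> separate them.\<close>

lemma filter_separated_common_limit:
  fixes x y :: "nat \<Rightarrow> real"
  assumes U: "absolute_ultrafilter U"
    and lim: "(x \<longlongrightarrow> L) U" "(y \<longlongrightarrow> L) U"
    and ne: "eventually (\<lambda>n. x n \<noteq> L) U" "eventually (\<lambda>n. y n \<noteq> L) U"
    and xy: "eventually (\<lambda>n. x n \<noteq> y n) U"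
  shows "filter_separated U x y"
proof -
  have UF: "ultrafilter U"
    using U by (simp add: absolute_ultrafilter_def nontrivial_ultrafilter_def)
  consider "eventually (\<lambda>n. dist (x n) L < dist (y n) L) U"
    | "eventually (\<lambda>n. dist (y n) L < dist (x n) L) U"
    | "eventually (\<lambda>n. \<not> dist (x n) L < dist (y n) L) U"
      "eventually (\<lambda>n. \<not> dist (y n) L < dist (x n) L) U"
    using ultrafilter_eventually_cases[OF UF] by blast
  then show ?thesis
  proof cases
    case 1
    then show ?thesis
      using filter_separated_of_closer[OF U lim ne] by blast
  next
    case 2
    then show ?thesis
      using filter_separated_of_closer[OF U lim(2,1) ne(2,1)] filter_separated_sym by blast
  next
    case 3
    then have refl: "eventually (\<lambda>n. y n - L = L - x n) U"
      using xy by eventually_elim (auto simp: dist_real_def abs_if split: if_splits)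
    show ?thesis
      using ultrafilter_eventually_cases[OF UF, of "\<lambda>n. x n < L"]
    proof
      assume "eventually (\<lambda>n. x n < L) U"
      moreover from this refl have "eventually (\<lambda>n. y n > L) U"
        by eventually_elim linarith
      ultimately show ?thesis
        by (intro filter_separatedI[of "{..<L}" "{L<..}"]) auto
    next
      assume "eventually (\<lambda>n. \<not> x n < L) U"
      with ne(1) have "eventually (\<lambda>n. x n > L) U"
        by eventually_elim linarith
      moreover from this refl have "eventually (\<lambda>n. y n < L) U"
        by eventually_elim linarith
      ultimately show ?thesis
        by (intro filter_separatedI[of "{L<..}" "{..<L}"]) auto
    qed
  qed
qed

lemma filter_separated_bounded:
  fixes x y :: "nat \<Rightarrow> real"
  assumes U: "absolute_ultrafilter U"
    and bdd: "bounded (range x)" "bounded (range y)"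
    and nonconst: "\<And>c. \<not> eventually (\<lambda>n. x n = c) U" "\<And>c. \<not> eventually (\<lambda>n. y n = c) U"
    and xy: "\<not> eventually (\<lambda>n. x n = y n) U"
  shows "filter_separated U x y"
proof -
  have UF: "ultrafilter U"
    using U by (simp add: absolute_ultrafilter_def nontrivial_ultrafilter_def)
  have ex: "\<exists>L. (z \<longlongrightarrow> L) U" if "bounded (range z)" for z :: "nat \<Rightarrow> real"
  proof -
    have "compact (closure (range z))"
      using that by simp
    moreover have "eventually (\<lambda>n. z n \<in> closure (range z)) U"
      using closure_subset[of "range z"] by (auto intro!: always_eventually)
    ultimately show ?thesis
      using ultrafilter_tendsto_compact[OF UF] by metis
  qed
  obtain L where L: "(x \<longlongrightarrow> L) U" using ex[OF bdd(1)] by blast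
  obtain M where M: "(y \<longlongrightarrow> M) U" using ex[OF bdd(2)] by blast
  show ?thesis
  proof (cases "L = M")
    case True
    show ?thesis
      by (rule filter_separated_common_limit[OF U L])
        (use M True nonconst xy in \<open>simp_all add: ultrafilter_not_eventually_iff[OF UF]\<close>)
  next
    case False
    then obtain V W where "open V" "open W" "L \<in> V" "M \<in> W" "V \<inter> W = {}"
      using hausdorff by metis
    then show ?thesis
      using L M by (meson filter_separatedI topological_tendstoD)
  qed
qed

text \<open>Injectivity of \<open>arctan\<close> preserves the hypotheses, boundedness provides
  limits, and continuity pulls the separating open sets back.\<close>

lemma filter_separated_nonconstant:
  fixes x y :: "nat \<Rightarrow> real"
  assumes U: "absolute_ultrafilter U"
    and nonconst: "\<And>c. \<not> eventually (\<lambda>n. x n = c) U" "\<And>c. \<not> eventually (\<lambda>n. y n = c) U"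
    and xy: "\<not> eventually (\<lambda>n. x n = y n) U"
  shows "filter_separated U x y"
proof -
  have UF: "ultrafilter U"
    using U by (simp add: absolute_ultrafilter_def nontrivial_ultrafilter_def)
  have bdd: "bounded (range (\<lambda>n. arctan (z n)))" for z :: "nat \<Rightarrow> real"
    by (rule bounded_subset[OF bounded_closed_interval[of "- (pi / 2)" "pi / 2"]])
      (use arctan_lbound arctan_ubound in \<open>fastforce intro: less_imp_le\<close>)
  have nc: "\<not> eventually (\<lambda>n. arctan (z n) = c) U"
    if "\<And>c. \<not> eventually (\<lambda>n. z n = c) U" for z c
  proof
    assume ev: "eventually (\<lambda>n. arctan (z n) = c) U"
    \<comment> \<open>As \<open>U\<close> is proper, some index attains \<open>c\<close>; hence
      \<open>c\<close> is in the range of \<open>arctan\<close>, and \<open>z k\<close> is the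
      candidate constant.\<close>
    then obtain k where "arctan (z k) = c"
      using UF eventually_happens' by (auto simp: ultrafilter_def)
    with ev have "eventually (\<lambda>n. z n = z k) U"
      by (auto simp: arctan_eq_iff)
    then show False
      using that by blast
  qed
  have "filter_separated U (\<lambda>n. arctan (x n)) (\<lambda>n. arctan (y n))"
    by (rule filter_separated_bounded[OF U bdd bdd nc nc])
      (use nonconst xy in \<open>simp_all add: arctan_eq_iff\<close>)
  then obtain V W where VW: "open V" "open W" "V \<inter> W = {}"
      "eventually (\<lambda>n. arctan (x n) \<in> V) U" "eventually (\<lambda>n. arctan (y n) \<in> W) U"
    unfolding filter_separated_def by blast
  have "open (arctan -` V)" "open (arctan -` W)"
    using VW(1,2) by (auto intro!: open_vimage continuous_intros)
  then show ?thesis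
    by (rule filter_separatedI) (use VW in auto)
qed

section \<open>Transfer to the space of nonstandard hyperreals\<close>

lemma nonstandard_hyperrealE:
  assumes "X \<in> hyperreals U - standard_reals U"
  obtains x where "X = seq_equiv U `` {x}" "\<And>c. \<not> eventually (\<lambda>n. x n = c) U"
proof -
  obtain x where x: "X = seq_equiv U `` {x}"
    using assms by (auto simp: hyperreals_def elim: quotientE)
  have "\<not> eventually (\<lambda>n. x n = c) U" for c
  proof
    assume "eventually (\<lambda>n. x n = c) U"
    then have "(x, \<lambda>n. c) \<in> seq_equiv U"
      by (simp add: seq_equiv_def in_filter_def)
    then have "X = seq_equiv U `` {\<lambda>n. c}"
      unfolding x by (rule equiv_class_eq[OF equiv_seq_equiv])
    then show False
      using assms by (auto simp: standard_reals_def)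
  qed
  then show ?thesis
    using that x by blast
qed

theorem theorem3p7:
  fixes U :: "nat filter"
  assumes "absolute_ultrafilter U"
  shows "Hausdorff_space
    (pullback_topology (hyperreals U - standard_reals U) (hyper_embed U)
      (s_topology (euclidean :: real topology)))"
  unfolding Hausdorff_space_def
proof (intro allI impI, elim conjE)
  let ?N = "hyperreals U - standard_reals U"
  let ?T = "pullback_topology ?N (hyper_embed U) (s_topology (euclidean :: real topology))"
  have UF: "ultrafilter U"
    using assms by (simp add: absolute_ultrafilter_def nontrivial_ultrafilter_def)
  fix X Y assume "X \<in> topspace ?T" "Y \<in> topspace ?T" and XY: "X \<noteq> Y"
  then have X: "X \<in> ?N" and Y: "Y \<in> ?N"
    by (auto simp: topspace_pullback_topology)
  obtain x where x: "X = seq_equiv U `` {x}" "\<And>c. \<not> eventually (\<lambda>n. x n = c) U"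
    using nonstandard_hyperrealE[OF X] by blast
  obtain y where y: "Y = seq_equiv U `` {y}" "\<And>c. \<not> eventually (\<lambda>n. y n = c) U"
    using nonstandard_hyperrealE[OF Y] by blast
  have "(x, y) \<notin> seq_equiv U"
    using XY x(1) y(1) equiv_class_eq[OF equiv_seq_equiv] by blast
  then have "\<not> eventually (\<lambda>n. x n = y n) U"
    by (simp add: seq_equiv_def in_filter_def)
  then have "filter_separated U x y"
    by (rule filter_separated_nonconstant[OF assms x(2) y(2)])
  then obtain V W where VW: "open V" "open W" "V \<inter> W = {}"
      "eventually (\<lambda>n. x n \<in> V) U" "eventually (\<lambda>n. y n \<in> W) U"
    unfolding filter_separated_def by blast
  \<comment> \<open>Traces of basic open sets on the nonstandard hyperreals, which are open in the
    induced topology.\<close>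
  define nb where "nb = (\<lambda>S. hyper_embed U -` s_basic (euclidean :: real topology) S \<inter> ?N)"
  have nb_open: "openin ?T (nb S)" if "open S" for S
    unfolding openin_pullback_topology nb_def
    using openin_s_basic[of euclidean S] that by auto
  have nb_mem: "Z \<in> nb S"
    if "Z \<in> ?N" "Z = seq_equiv U `` {z}" "open S" "eventually (\<lambda>n. z n \<in> S) U" for Z z S
    using that seq_s_filter_in_s_filters[OF UF, of z]
    by (simp add: nb_def s_basic_def hyper_embed_class) (simp add: seq_s_filter_def in_filter_def)
  have "disjnt (nb V) (nb W)"
  proof -
    \<comment> \<open>No s-filter contains the empty set, so disjointness of \<open>V\<close> and
      \<open>W\<close> passes to their basic sets.\<close>
    have "s_basic euclidean (V \<inter> W) = {}"
      unfolding VW(3) by (auto simp: s_basic_def s_filters_def s_filter_def tau_filter_def)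
    then have "s_basic euclidean V \<inter> s_basic euclidean W = {}"
      using s_basic_Int[of euclidean V W] VW(1,2) by simp
    then show ?thesis
      by (auto simp: nb_def disjnt_def)
  qed
  then show "\<exists>P Q. openin ?T P \<and> openin ?T Q \<and> X \<in> P \<and> Y \<in> Q \<and> disjnt P Q"
    using nb_open[OF VW(1)] nb_open[OF VW(2)] nb_mem[OF X x(1) VW(1,4)] nb_mem[OF Y y(1) VW(2,5)]
    by (intro exI conjI)
qed

end
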